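(* Consider a two-stripe symmetric circulant TSP instance with parameters $n,a_1,a_2$ satisfying the standing assumptions below, let $g_1=\gcd(n,a_1)$, $c=g_1$, and suppose $g_1+1<\frac{n}{g_1}$. Let $$S=\left\{y\in\mathbb{Z}: 0\le y<\tfrac{n}{g_1},\ (2y-g_1)a_1+g_1a_2\equiv 0 \pmod n\right\}.$$ Assume $S$ is nonempty, let $y_1=\min S$ and $y_2=\max S$, and assume $y_1>g_1$. Assume further that the cost of an optimal tour is strictly between $c$ and $2c-2$. Then the cost of an optimal tour is $c+2m^*$ if and only if $m^*=\min\{y_1-g_1,\ \frac{n}{g_1}-y_2\}$.
   Context: Two-stripe symmetric circulant TSP: the vertex set is $\mathbb{Z}_n$, and for two distinct integers $a_1,a_2\in\{1,\dots,\lfloor n/2\rfloor\}$ the only finite-cost edges are $\{v,v\pm a_1\bmod n\}$ (cost $0$) and $\{v,v\pm a_2\bmod n\}$ (cost $1$); a tour is a Hamiltonian cycle and its cost is the number of edges of length $a_2$ it uses. Standing assumptions: $\gcd(n,a_1)>1$ and $\gcd(n,a_1,a_2)=1$. *)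

theory Defs
  imports Main "HOL-Number_Theory.Cong"
begin

(* The vertices of Z_n are represented by {..<n}. Since edges are unordered pairs, ranging over
   all v makes {v, v + a mod n} cover both {v, v + a} and {v, v - a}. *)
definition stripe_edges :: "nat \<Rightarrow> nat \<Rightarrow> nat set set" where
  "stripe_edges n a = {{v, (v + a) mod n} | v. v < n}"

(* Edge set of the closed walk T ! 0, T ! 1, ..., T ! (length T - 1), T ! 0. *)
definition cycle_edges :: "nat list \<Rightarrow> nat set set" where
  "cycle_edges T = {{T ! i, T ! (Suc i mod length T)} | i. i < length T}"

(* Edges outside the two stripes have infinite cost, so a tour is a Hamiltonian cycle of the
   graph formed by the two stripes. The bound on n excludes degenerate cycles. *)
definition is_tour :: "nat \<Rightarrow> nat \<Rightarrow> nat \<Rightarrow> nat list \<Rightarrow> bool" where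
  "is_tour n a1 a2 T \<longleftrightarrow>
     3 \<le> n \<and> distinct T \<and> set T = {..<n} \<and>
     cycle_edges T \<subseteq> stripe_edges n a1 \<union> stripe_edges n a2"

(* For distinct a1, a2 in {1..n div 2} the two stripes are disjoint; a1-edges are free. *)
definition tour_cost :: "nat \<Rightarrow> nat \<Rightarrow> nat list \<Rightarrow> nat" where
  "tour_cost n a2 T = card (cycle_edges T \<inter> stripe_edges n a2)"

definition is_optimal_tour :: "nat \<Rightarrow> nat \<Rightarrow> nat \<Rightarrow> nat list \<Rightarrow> bool" where
  "is_optimal_tour n a1 a2 T \<longleftrightarrow>
     is_tour n a1 a2 T \<and> (\<forall>T'. is_tour n a1 a2 T' \<longrightarrow> tour_cost n a2 T \<le> tour_cost n a2 T')"

end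

theory Submission
  imports Defs
begin

text \<open>
  Put \<open>g = gcd n a1\<close>, \<open>r = n div g\<close> and write a vertex as \<open>x * a2 + y * a1\<close>. This is a twisted toroidal
  grid with \<open>g\<close> columns, each a cycle of length \<open>r\<close>; the cost of a tour is its number of horizontal edges.

  Lower bound. Since all degrees are 2, the numbers of tour edges between consecutive columns all have
  the same parity. If they are even, connectedness allows at most one of them to vanish and the cost is
  at least \<open>2 * g - 2\<close>. Otherwise some pair of neighbouring columns is joined by a single edge; cut the
  torus open there. The number of vertical edges between two consecutive levels then changes parity
  only at the levels of the two ends of that edge, so on one of the two arcs between these levels every
  level misses an odd number of vertical edges. Altogether exactly as many vertical edges are missing
  as horizontal edges are used, so the cost is at least the length of the arc, and of the same parity.

  Upper bound. If \<open>N = g + 2 * m \<le> r\<close> is such an arc length, omit one vertical edge on each of \<open>N\<close>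
  consecutive levels, the omitted edge moving by one column from a level to the next, from the first
  column to the last. The horizontal edges that repair the degrees only shift strands past the gap and
  preserve their order, so one turn around the columns carries strand \<open>i\<close> to strand \<open>i - 1\<close> and the
  result is a single cycle.
\<close>

section \<open>A cyclic permutation of the grid\<close>

lemma funpow_periodic_enumerates:
  assumes fin: "finite X" and range: "range (\<lambda>k. (f ^^ k) x) = X"
    and per: "(f ^^ j) x = x" "0 < j"
  shows "inj_on (\<lambda>k. (f ^^ k) x) {..<card X}" (is "inj_on ?F _")
    and "(\<lambda>k. (f ^^ k) x) ` {..<card X} = X"
    and "(f ^^ card X) x = x"
proof -
  have mod_period: "?F k = ?F (k mod p)" if "?F p = x" for k p
    using that by (metis funpow_mod_eq)
  \<comment> \<open>The given period \<open>j\<close> need not be minimal. On the least period the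
    orbit is injective, so that period has to be \<open>card X\<close>.\<close>
  define p where "p = (LEAST p. 0 < p \<and> ?F p = x)"
  have p: "0 < p" "?F p = x"
    unfolding p_def using LeastI[of "\<lambda>p. 0 < p \<and> ?F p = x" j] per by auto
  have least: "p \<le> q" if "0 < q" "?F q = x" for q
    unfolding p_def using that by (intro Least_le) auto
  have img: "?F ` {..<p} = X"
  proof -
    have "?F k \<in> ?F ` {..<p}" for k
      using mod_period[OF p(2), of k] p(1) by (intro image_eqI[of _ _ "k mod p"]) auto
    then show ?thesis unfolding range[symmetric] by blast
  qed
  have inj: "inj_on ?F {..<p}"
  proof (rule linorder_inj_onI')
    fix i k assume ik: "i \<in> {..<p}" "k \<in> {..<p}" "i < k"
    show "?F i \<noteq> ?F k"
    proof
      assume "?F i = ?F k"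
      then have "(f ^^ (p - k)) (?F i) = (f ^^ (p - k)) (?F k)" by simp
      then have "?F (p - k + i) = ?F (p - k + k)" by (simp add: funpow_add)
      then have "?F (p - k + i) = x" using ik p by simp
      then have "p \<le> p - k + i" using ik by (intro least) auto
      then show False using ik by auto
    qed
  qed
  have "card X = p" using card_image[OF inj] img by simp
  then show "inj_on ?F {..<card X}" "?F ` {..<card X} = X" "(f ^^ card X) x = x"
    using inj img p by auto
qed

text \<open>A walk over the columns with steps \<open>\<plusminus>1\<close> from column \<open>0\<close> to column \<open>g - 1\<close>, reached at level
  \<open>g + 2 * m - 1\<close>: it oscillates between columns \<open>0\<close> and \<open>1\<close> first and then moves right. The tour
  omits the vertical edge above \<open>(gap m y, y)\<close> and closes the hole by stepping sideways.\<close>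

definition gap :: "nat \<Rightarrow> nat \<Rightarrow> nat" where
  "gap m y = (if y \<le> 2 * m then y mod 2 else y - 2 * m)"

text \<open>The cell \<open>(gap m (y - 1), y)\<close> is the one that lost its edge from below, so
  the sideways step feeds it. At \<open>y = 0\<close> the step crosses the seam: the cell left of
  \<open>(0, 0)\<close> is column \<open>g - 1\<close> at level \<open>g + 2 * m\<close>, just above
  the last omitted edge.\<close>

fun gap_step :: "nat \<Rightarrow> nat \<Rightarrow> nat \<Rightarrow> nat \<times> nat \<Rightarrow> nat \<times> nat" where
  "gap_step g r m (x, y) =
     (if y < g + 2 * m \<and> x = gap m y
      then (if y = 0 then (g - 1, (g + 2 * m) mod r) else (gap m (y - 1), y))
      else (x, (y + 1) mod r))"

lemma gap_0 [simp]: "gap m 0 = 0"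
  by (simp add: gap_def)

lemma gap_last: "2 \<le> g \<Longrightarrow> gap m (g + 2 * m - 1) = g - 1"
  by (auto simp: gap_def)

lemma gap_less: "2 \<le> g \<Longrightarrow> y < g + 2 * m \<Longrightarrow> gap m y < g"
  by (auto simp: gap_def)

lemma gap_Suc: "gap m (Suc y) = Suc (gap m y) \<or> gap m y = Suc (gap m (Suc y))"
  unfolding gap_def by (cases "Suc y \<le> 2 * m"; cases "y = 2 * m") (auto simp: mod_Suc)

text \<open>Applied to the orbit of \<open>(0, 0)\<close>, this excludes short cycles. A strand
  starting in column \<open>Suc k\<close> of level 0 has \<open>k\<close> strands to its left,
  because the gap is in column 0; it leaves level \<open>N - 1\<close> in column \<open>k\<close>,
  because the gap is then in the last column.\<close>

lemma step_closed_covers: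
  assumes g: "2 \<le> g" and N: "g + 2 * m \<le> r"
    and R0: "(0, 0) \<in> R" and closed: "\<And>p. p \<in> R \<Longrightarrow> gap_step g r m p \<in> R"
  shows "{..<g} \<times> {..<r} \<subseteq> R"
proof -
  define N where "N = g + 2 * m"
  \<comment> \<open>The strand with exactly \<open>k\<close> other strands to its left. A sideways step exchanges a strand with
    the gap, so it preserves \<open>k\<close>; this is why the tour cannot close up early.\<close>
  define strand where "strand k y = (if k < gap m y then k else Suc k)" for k y
  have N_le: "N \<le> r" and N2: "2 \<le> N" using N g by (auto simp: N_def)
  have up: "(x, Suc y mod r) \<in> R" if "(x, y) \<in> R" "\<not> (y < N \<and> x = gap m y)" for x y
    using closed[OF that(1)] that(2) by (auto simp: N_def split: if_splits)
  have side: "(gap m y, Suc y) \<in> R" if "(gap m (Suc y), Suc y) \<in> R" "Suc y < N" for y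
    using closed[OF that(1)] that(2) by (auto simp: N_def)
  have strand_neq: "strand k y \<noteq> gap m y" for k y
    by (auto simp: strand_def)
  have above: "(j, y) \<in> R" if "(j, N mod r) \<in> R" "N \<le> y" "y < r" for j y
    using that(2,3)
  proof (induction y rule: dec_induct)
    case base then show ?case using that(1) by simp
  next
    case (step y) then show ?case using up[of j y] by simp
  qed
  \<comment> \<open>From level \<open>N\<close> on no vertical edge is omitted, so a strand climbs
    straight and wraps round. If \<open>N = r\<close> there are no such levels and
    \<open>N mod r\<close> is already 0.\<close>
  have bottom: "(j, 0) \<in> R" if "(j, N mod r) \<in> R" for j
  proof (cases "N = r")
    case True then show ?thesis using that by simp
  next
    case False
    then have "(j, r - 1) \<in> R" using above[OF that, of "r - 1"] N_le by auto
    then show ?thesis using up[of j "r - 1"] False N_le N2 by auto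
  qed
  have along: "(strand k y, y) \<in> R" if "(Suc k, 0) \<in> R" "y < N" for k y
    using that(2)
  proof (induction y)
    case 0 then show ?case using that(1) by (simp add: strand_def)
  next
    case (Suc y)
    then have *: "(strand k y, Suc y) \<in> R"
      using up[of "strand k y" y] strand_neq N_le by auto
    show ?case
    proof (cases "strand k y = strand k (Suc y)")
      case True then show ?thesis using * by simp
    next
      case False
      \<comment> \<open>The gap has moved into the column of the strand, and the sideways step puts
        the strand into the column that the gap has left.\<close>
      then have "strand k y = gap m (Suc y)" "strand k (Suc y) = gap m y"
        using gap_Suc[of m y] by (auto simp: strand_def split: if_splits)
      then show ?thesis using side[of y] * Suc.prems by simp
    qed
  qed
  \<comment> \<open>Induction on the number of turns: the seam step from \<open>(0, 0)\<close>
    enters column \<open>g - 1\<close>, and every turn moves the entry one column to the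
    left.\<close>
  have entry: "(g - 1 - i, N mod r) \<in> R" if "i < g" for i
    using that
  proof (induction i)
    case 0
    then show ?case using closed[OF R0] N2 by (simp add: N_def)
  next
    case (Suc i)
    define k where "k = g - 1 - Suc i"
    have k: "Suc k = g - 1 - i" "k < g - 1" using Suc.prems by (auto simp: k_def)
    then have "(strand k (N - 1), N - 1) \<in> R"
      using Suc bottom[of "Suc k"] N2 by (intro along) auto
    moreover have "strand k (N - 1) = k"
      using gap_last[OF g, of m] k by (simp add: strand_def N_def)
    ultimately have "(k, N mod r) \<in> R"
      using up[of k "N - 1"] gap_last[OF g, of m] k(2) N2 by (simp flip: N_def)
    then show ?case by (simp only: k_def)
  qed
  have entry': "(j, N mod r) \<in> R" if "j < g" for j
    using entry[of "g - 1 - j"] that by simp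
  have off_gap: "(x, y) \<in> R" if "x < g" "y < N" "x \<noteq> gap m y" for x y
  proof -
    define k where "k = (if x < gap m y then x else x - 1)"
    have "x = strand k y" "Suc k < g"
      using that gap_less[OF g, of y m] by (auto simp: k_def strand_def N_def)
    then show ?thesis using along[of k y] bottom entry' that by auto
  qed
  have "(x, y) \<in> R" if xy: "x < g" "y < r" for x y
  proof (cases "y < N")
    case False then show ?thesis using above entry' xy by auto
  next
    case True
    show ?thesis
    proof (cases "x = gap m y")
      case False then show ?thesis using off_gap xy True by blast
    next
      case x: True
      show ?thesis
      proof (cases y)
        case 0 then show ?thesis using R0 x by simp
      next
        case (Suc y')
        \<comment> \<open>A gap cell above level 0 is entered from directly below, where the gap is
          one column aside.\<close>
        then have "x \<noteq> gap m y'" using gap_Suc[of m y'] x by (metis n_not_Suc_n)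
        moreover from this have "(x, y') \<in> R" using off_gap[of x y'] xy Suc True by simp
        ultimately have "(x, Suc y' mod r) \<in> R" by (intro up) simp_all
        then show ?thesis using Suc xy by simp
      qed
    qed
  qed
  then show ?thesis by auto
qed

lemma step_cyclic:
  assumes g: "2 \<le> g" and N: "g + 2 * m \<le> r"
  defines "F \<equiv> \<lambda>k. (gap_step g r m ^^ k) (0, 0)"
  shows "inj_on F {..<g * r}" and "F ` {..<g * r} = {..<g} \<times> {..<r}" and "F (g * r) = (0, 0)"
proof -
  have r: "0 < r" using g N by auto
  have box: "F k \<in> {..<g} \<times> {..<r}" for k
  proof (induction k)
    case 0 then show ?case using g r by (simp add: F_def)
  next
    case (Suc k)
    have "gap_step g r m p \<in> {..<g} \<times> {..<r}" if "p \<in> {..<g} \<times> {..<r}" for p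
      using that r g gap_less[OF g, of "snd p - 1" m] by (cases p) auto
    from this[OF Suc] show ?case by (simp add: F_def)
  qed
  have "{..<g} \<times> {..<r} \<subseteq> range F"
  proof (rule step_closed_covers[OF g N])
    show "(0, 0) \<in> range F" by (rule range_eqI[of _ _ 0]) (simp add: F_def)
    show "gap_step g r m p \<in> range F" if "p \<in> range F" for p
    proof -
      from that obtain k where "p = F k" by auto
      then show ?thesis by (intro range_eqI[of _ _ "Suc k"]) (simp add: F_def)
    qed
  qed
  then have rng: "range F = {..<g} \<times> {..<r}" using box by blast
  then have "(0, r - 1) \<in> range F" using r g by auto
  then obtain k where "F k = (0, r - 1)" by auto
  \<comment> \<open>The top level has a gap only if \<open>r = g + 2 * m\<close>, and then in column
    \<open>g - 1\<close>, which is not column 0.\<close>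
  moreover have "gap_step g r m (0, r - 1) = (0, 0)"
    using gap_last[OF g, of m] g N r by (cases "r = g + 2 * m") auto
  ultimately have "F (Suc k) = (0, 0)" by (simp add: F_def)
  then have "inj_on F {..<card ({..<g} \<times> {..<r})}" "F ` {..<card ({..<g} \<times> {..<r})} = {..<g} \<times> {..<r}"
    "F (card ({..<g} \<times> {..<r})) = (0, 0)"
    using funpow_periodic_enumerates[of "{..<g} \<times> {..<r}" "gap_step g r m" "(0, 0)" "Suc k"] rng
    unfolding F_def by auto
  then show "inj_on F {..<g * r}" "F ` {..<g * r} = {..<g} \<times> {..<r}" "F (g * r) = (0, 0)"
    by (simp_all add: card_cartesian_product)
qed


section \<open>Vertices, stripes and grid coordinates\<close>

text \<open>Arbitrary integers name vertices, so that subtraction is not truncated and equality of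
  vertices is a congruence.\<close>

definition vtx :: "nat \<Rightarrow> int \<Rightarrow> nat" where
  "vtx n z = nat (z mod int n)"

lemma vtx_eq_iff: "0 < n \<Longrightarrow> vtx n z = vtx n w \<longleftrightarrow> [z = w] (mod int n)"
  by (simp add: vtx_def cong_def nat_eq_iff)

lemma vtx_less: "0 < n \<Longrightarrow> vtx n z < n"
  by (simp add: vtx_def nat_less_iff)

lemma vtx_of_nat: "v < n \<Longrightarrow> vtx n (int v) = v"
  by (simp add: vtx_def)

lemma vtx_add:
  assumes "0 < n"
  shows "(vtx n z + a) mod n = vtx n (z + int a)"
proof -
  have "int (vtx n z) = z mod int n" using assms by (simp add: vtx_def)
  then have "int ((vtx n z + a) mod n) = (z + int a) mod int n"
    by (simp add: zmod_int mod_add_left_eq)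
  then show ?thesis unfolding vtx_def by (metis nat_int)
qed

lemma stripe_edges_eq:
  assumes "0 < n"
  shows "stripe_edges n a = {{vtx n z, vtx n (z + int a)} | z. True}"
proof (intro set_eqI iffI)
  fix e assume "e \<in> stripe_edges n a"
  then obtain v where "v < n" "e = {v, (v + a) mod n}" by (auto simp: stripe_edges_def)
  then show "e \<in> {{vtx n z, vtx n (z + int a)} | z. True}"
    using vtx_add[OF assms, of "int v" a] vtx_of_nat[of v n] by (auto intro!: exI[of _ "int v"])
next
  fix e assume "e \<in> {{vtx n z, vtx n (z + int a)} | z. True}"
  then obtain z where "e = {vtx n z, vtx n (z + int a)}" by auto
  then show "e \<in> stripe_edges n a"
    using vtx_add[OF assms, of z a] vtx_less[OF assms, of z]
    by (auto simp: stripe_edges_def intro!: exI[of _ "vtx n z"])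
qed

lemma mem_stripe_edges_iff:
  assumes "0 < n"
  shows "{vtx n z, vtx n w} \<in> stripe_edges n a \<longleftrightarrow>
    [w = z + int a] (mod int n) \<or> [z = w + int a] (mod int n)"
proof
  assume "{vtx n z, vtx n w} \<in> stripe_edges n a"
  then obtain u where "{vtx n z, vtx n w} = {vtx n u, vtx n (u + int a)}"
    using stripe_edges_eq[OF assms] by auto
  then have "[z = u] (mod int n) \<and> [w = u + int a] (mod int n) \<or>
      [z = u + int a] (mod int n) \<and> [w = u] (mod int n)"
    by (auto simp: doubleton_eq_iff vtx_eq_iff[OF assms])
  then show "[w = z + int a] (mod int n) \<or> [z = w + int a] (mod int n)"
    by (meson cong_add_rcancel cong_sym cong_trans)
next
  assume "[w = z + int a] (mod int n) \<or> [z = w + int a] (mod int n)"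
  then have "vtx n w = vtx n (z + int a) \<or> vtx n z = vtx n (w + int a)"
    by (simp add: vtx_eq_iff[OF assms])
  then show "{vtx n z, vtx n w} \<in> stripe_edges n a"
    using stripe_edges_eq[OF assms] by (auto simp: insert_commute)
qed

text \<open>A common edge would make \<open>n\<close> divide \<open>a1 - a2\<close> or
  \<open>a1 + a2\<close>, but both are nonzero and smaller than \<open>n\<close> in absolute
  value.\<close>

lemma stripe_edges_disjoint:
  assumes a: "a1 \<in> {1..n div 2}" "a2 \<in> {1..n div 2}" "a1 \<noteq> a2"
  shows "stripe_edges n a1 \<inter> stripe_edges n a2 = {}"
proof (rule ccontr)
  assume "stripe_edges n a1 \<inter> stripe_edges n a2 \<noteq> {}"
  moreover have n: "0 < n" using a by auto
  ultimately obtain z where "{vtx n z, vtx n (z + int a1)} \<in> stripe_edges n a2"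
    using stripe_edges_eq[OF n, of a1] by auto
  then have "[z + int a1 = z + int a2] (mod int n) \<or> [z = z + int a1 + int a2] (mod int n)"
    using mem_stripe_edges_iff[OF n] by blast
  then have "int n dvd int a1 - int a2 \<or> int n dvd int a1 + int a2"
    by (auto simp: cong_iff_dvd_diff) (metis dvd_minus_iff minus_add_distrib minus_diff_eq add_uminus_conv_diff add.commute)
  then show False
  proof
    assume "int n dvd int a1 - int a2"
    then have "int n dvd \<bar>int a1 - int a2\<bar>" by simp
    then show False using a zdvd_imp_le[of "int n" "\<bar>int a1 - int a2\<bar>"] by auto
  next
    assume "int n dvd int a1 + int a2"
    then show False using a zdvd_imp_le[of "int n" "int a1 + int a2"] by auto
  qed
qed

text \<open>Modulo \<open>g\<close> the multiple of \<open>b\<close> vanishes and \<open>a2\<close>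
  is a unit, which fixes the column. After division by \<open>g\<close>, \<open>b div g\<close> is
  coprime to \<open>n div g\<close>, which fixes the level. Both signs of \<open>b\<close> are
  needed because the cheap tour may wind in either vertical direction.\<close>

lemma inj_on_coordinates:
  fixes n a1 a2 :: nat and b :: int
  assumes n: "0 < n" and g: "g = gcd n a1" and cop: "coprime g a2" and b: "b = int a1 \<or> b = - int a1"
  shows "inj_on (\<lambda>(x, y). vtx n (int x * int a2 + int y * b)) ({..<g} \<times> {..<n div g})"
proof (rule inj_onI, clarify)
  fix x y x' y' assume xy: "x < g" "x' < g" "y < n div g" "y' < n div g"
    and eq: "vtx n (int x * int a2 + int y * b) = vtx n (int x' * int a2 + int y' * b)"
  define r where "r = n div g"
  have nr: "n = g * r" and gb: "int g dvd b" "0 < g" using n g b by (auto simp: r_def)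
  have dvd: "int n dvd (int x - int x') * int a2 + (int y - int y') * b"
    using eq by (simp add: vtx_eq_iff[OF n] cong_iff_dvd_diff algebra_simps)
  then have "int g dvd (int x - int x') * int a2 + (int y - int y') * b"
    using nr by (auto dest: dvd_mult_left)
  then have "int g dvd (int x - int x') * int a2"
    using gb(1) by (simp add: dvd_add_left_iff)
  then have "int g dvd int x - int x'"
    using cop by (simp add: coprime_dvd_mult_left_iff)
  then have x: "x = x'" using xy zdvd_imp_le[of "int g" "\<bar>int x - int x'\<bar>"] by fastforce
  have "coprime (n div g) (a1 div g)"
    using n g by (simp add: div_gcd_coprime)
  then have "coprime (int r) (int a1 div int g)"
    unfolding r_def by (metis coprime_int_iff of_nat_div)
  moreover have "b div int g = int a1 div int g \<or> b div int g = - (int a1 div int g)"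
    using b g by (auto simp: dvd_neg_div)
  ultimately have "coprime (int r) (b div int g)" by auto
  have "(int x - int x') * int a2 + (int y - int y') * b = int g * ((int y - int y') * (b div int g))"
    using x gb by (simp add: mult.left_commute)
  then have "int g * int r dvd int g * ((int y - int y') * (b div int g))"
    using dvd nr by simp
  then have "int r dvd (int y - int y') * (b div int g)" using gb by simp
  then have "int r dvd int y - int y'"
    using \<open>coprime (int r) (b div int g)\<close> by (simp add: coprime_dvd_mult_left_iff)
  then have "y = y'"
    using xy zdvd_imp_le[of "int r" "\<bar>int y - int y'\<bar>"] unfolding r_def by fastforce
  with x show "x = x' \<and> y = y'" by simp
qed


section \<open>Upper bound: the tour on the grid\<close>

text \<open>The congruence \<open>shift\<close> is the twist of the torus that turns the seam step
  of \<open>gap_step\<close> into an edge of length \<open>a2\<close>. An inequality for the cost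
  suffices for comparison with an optimal tour and spares a proof that the sideways edges are
  distinct.\<close>

lemma tour_of_cost_le:
  fixes n a1 a2 g m :: nat and b :: int
  assumes a: "a1 \<in> {1..n div 2}" "a2 \<in> {1..n div 2}" "a1 \<noteq> a2"
    and g: "g = gcd n a1" "2 \<le> g" and cop: "coprime g a2"
    and N: "g + 2 * m \<le> n div g" and b: "b = int a1 \<or> b = - int a1"
    and shift: "[int g * int a2 + int (g + 2 * m) * b = 0] (mod int n)"
  shows "\<exists>T. is_tour n a1 a2 T \<and> tour_cost n a2 T \<le> g + 2 * m"
proof -
  define r where "r = n div g"
  have n: "0 < n" "3 \<le> n" using a by auto
  have nr: "n = g * r" using g(1) by (simp add: r_def)
  define enc where "enc = (\<lambda>(x, y). vtx n (int x * int a2 + int y * b))"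
  define F where "F k = (gap_step g r m ^^ k) (0, 0)" for k
  note F = step_cyclic[OF g(2) N[folded r_def], folded F_def, folded nr]
  have inj: "inj_on enc ({..<g} \<times> {..<r})"
    unfolding enc_def r_def by (rule inj_on_coordinates[OF n(1) g(1) cop b])
  define T where "T = map (\<lambda>i. enc (F i)) [0..<n]"
  have len: "length T = n" by (simp add: T_def)
  have nth: "T ! (i mod n) = enc (F i)" if "i \<le> n" for i
    using that n F(3) by (cases "i = n") (auto simp: T_def F_def)
  have dist: "distinct T"
    using comp_inj_on[OF F(1), of enc] inj F(2)
    by (simp add: T_def distinct_map comp_def atLeast0LessThan)
  have "set T \<subseteq> {..<n}" using vtx_less[OF n(1)] by (auto simp: T_def enc_def split: prod.split)
  moreover have "card (set T) = n" using dist len by (simp add: distinct_card)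
  ultimately have set: "set T = {..<n}" by (simp add: card_subset_eq)
  have edges: "cycle_edges T = (\<lambda>p. {enc p, enc (gap_step g r m p)}) ` ({..<g} \<times> {..<r})"
  proof -
    have "{T ! i, T ! (Suc i mod n)} = {enc (F i), enc (F (Suc i))}" if "i < n" for i
      using nth[of i] nth[of "Suc i"] that by simp
    then have "cycle_edges T = (\<lambda>i. {enc (F i), enc (F (Suc i))}) ` {..<n}"
      unfolding cycle_edges_def len by auto
    also have "\<dots> = (\<lambda>p. {enc p, enc (gap_step g r m p)}) ` F ` {..<n}"
      by (simp add: image_image F_def)
    finally show ?thesis using F(2) by simp
  qed
  have rb: "[int (y mod r) * b = int y * b] (mod int n)" for y
  proof -
    have "g * r dvd a1 * r" using g(1) by (intro mult_dvd_mono) auto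
    then have "int n dvd int r * int a1" unfolding nr by (metis mult.commute of_nat_dvd_iff of_nat_mult)
    then have "int n dvd int r * b" using b by auto
    moreover have "int y * b - int (y mod r) * b = int (y div r) * (int r * b)"
      by (metis (no_types) add_diff_cancel_right' div_mult_mod_eq left_diff_distrib mult.assoc of_nat_add of_nat_mult)
    ultimately show ?thesis by (simp add: cong_iff_dvd_diff dvd_diff_commute)
  qed
  define J where "J = (\<lambda>y. (gap m y, y)) ` {..<g + 2 * m}"
  have up: "{enc p, enc (gap_step g r m p)} \<in> stripe_edges n a1"
    if "p \<notin> J" for p
  proof (cases p)
    case (Pair x y)
    then have "\<not> (y < g + 2 * m \<and> x = gap m y)" using that by (auto simp: J_def)
    then have "gap_step g r m p = (x, Suc y mod r)"
      unfolding Pair by (simp only: gap_step.simps if_False Suc_eq_plus1)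
    then have step: "enc p = vtx n (int x * int a2 + int y * b)"
      "enc (gap_step g r m p) = vtx n (int x * int a2 + int (Suc y mod r) * b)"
      unfolding enc_def Pair by simp_all
    have "[int x * int a2 + int (Suc y mod r) * b = int x * int a2 + int (Suc y) * b] (mod int n)"
      by (intro cong_add cong_refl rb)
    also have "int x * int a2 + int (Suc y) * b = int x * int a2 + int y * b + b"
      by (simp add: algebra_simps)
    finally have up: "[int x * int a2 + int (Suc y mod r) * b = int x * int a2 + int y * b + b] (mod int n)" .
    show ?thesis
      using b
    proof
      assume "b = int a1"
      then show ?thesis
        using up unfolding step mem_stripe_edges_iff[OF n(1)] by blast
    next
      assume "b = - int a1"
      then have "[int x * int a2 + int y * b = int x * int a2 + int (Suc y mod r) * b + int a1] (mod int n)"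
        using cong_add[OF cong_sym[OF up] cong_refl[of "int a1"]] by simp
      then show ?thesis
        unfolding step mem_stripe_edges_iff[OF n(1)] by blast
    qed
  qed
  have side: "{enc p, enc (gap_step g r m p)} \<in> stripe_edges n a2" if "p \<in> J" for p
  proof -
    from that obtain y where y: "y < g + 2 * m" "p = (gap m y, y)" by (auto simp: J_def)
    show ?thesis
    proof (cases y)
      case 0
      then have "p = (0, 0)" "gap_step g r m p = (g - 1, (g + 2 * m) mod r)" using y by simp_all
      then have step: "enc p = vtx n 0"
        "enc (gap_step g r m p) = vtx n (int (g - 1) * int a2 + int ((g + 2 * m) mod r) * b)"
        unfolding enc_def by simp_all
      \<comment> \<open>The seam edge: one more \<open>a2\<close> completes \<open>g\<close>
        columns, and \<open>shift\<close> then gives 0.\<close>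
      have "[int (g - 1) * int a2 + int ((g + 2 * m) mod r) * b + int a2
          = int (g - 1) * int a2 + int (g + 2 * m) * b + int a2] (mod int n)"
        by (intro cong_add cong_refl rb)
      also have "int (g - 1) * int a2 + int (g + 2 * m) * b + int a2
          = int g * int a2 + int (g + 2 * m) * b"
        using g(2) by (simp add: of_nat_diff algebra_simps)
      also note shift
      finally have "[0 = int (g - 1) * int a2 + int ((g + 2 * m) mod r) * b + int a2] (mod int n)"
        by (rule cong_sym)
      then show ?thesis
        unfolding step mem_stripe_edges_iff[OF n(1)] by blast
    next
      case (Suc y')
      then have "p = (gap m y, y)" "gap_step g r m p = (gap m y', y)" using y by simp_all
      then have step: "enc p = vtx n (int (gap m y) * int a2 + int y * b)"
        "enc (gap_step g r m p) = vtx n (int (gap m y') * int a2 + int y * b)"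
        unfolding enc_def by simp_all
      have "int (gap m y) = int (gap m y') + 1 \<or> int (gap m y') = int (gap m y) + 1"
        using gap_Suc[of m y'] Suc by auto
      then show ?thesis
        unfolding step mem_stripe_edges_iff[OF n(1)]
        by (elim disjE) (simp_all add: algebra_simps)
    qed
  qed
  have "is_tour n a1 a2 T"
    unfolding is_tour_def edges using n dist set up side by (intro conjI image_subsetI) blast+
  moreover have "tour_cost n a2 T \<le> g + 2 * m"
  proof -
    have "cycle_edges T \<inter> stripe_edges n a2 \<subseteq> (\<lambda>p. {enc p, enc (gap_step g r m p)}) ` J"
      using stripe_edges_disjoint[OF a] up unfolding edges by blast
    then have "tour_cost n a2 T \<le> card ((\<lambda>p. {enc p, enc (gap_step g r m p)}) ` J)"
      unfolding tour_cost_def by (intro card_mono) (auto simp: J_def)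
    also have "\<dots> \<le> card J" by (rule card_image_le) (simp add: J_def)
    also have "\<dots> \<le> card {..<g + 2 * m}" unfolding J_def by (rule card_image_le) simp
    finally show ?thesis by simp
  qed
  ultimately show ?thesis by blast
qed

section \<open>Summation over residues; degrees and connectedness of a tour\<close>

lemma sum_periodic_shift:
  fixes f :: "int \<Rightarrow> nat"
  assumes n: "0 < n" and f: "\<And>z w. [z = w] (mod int n) \<Longrightarrow> f z = f w"
  shows "(\<Sum>v<n. f (c + int v)) = (\<Sum>v<n. f (int v))"
proof -
  have inj: "inj_on (\<lambda>v. vtx n (c + int v)) {..<n}"
  proof (rule inj_onI)
    fix v w assume vw: "v \<in> {..<n}" "w \<in> {..<n}" and "vtx n (c + int v) = vtx n (c + int w)"
    then have "[int v = int w] (mod int n)"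
      by (simp add: vtx_eq_iff[OF n] cong_add_lcancel)
    then show "v = w" using vw by (simp add: cong_def)
  qed
  then have "(\<lambda>v. vtx n (c + int v)) ` {..<n} = {..<n}"
    by (intro endo_inj_surj) (auto simp: vtx_less[OF n])
  with inj have "(\<Sum>v<n. f (int v)) = (\<Sum>v<n. f (int (vtx n (c + int v))))"
    using sum.reindex[OF inj, of "\<lambda>v. f (int v)"] by (simp add: comp_def)
  also have "\<dots> = (\<Sum>v<n. f (c + int v))"
    using n by (intro sum.cong refl f) (simp add: vtx_def cong_def)
  finally show ?thesis by simp
qed

text \<open>Permits counting edges by columns or by levels, from any origin
  \<open>c\<close>.\<close>

lemma sum_coordinates:
  fixes f :: "int \<Rightarrow> nat"
  assumes n: "0 < n" and g: "g = gcd n a1" and cop: "coprime g a2"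
    and f: "\<And>z w. [z = w] (mod int n) \<Longrightarrow> f z = f w"
  shows "(\<Sum>x<g. \<Sum>y<n div g. f (c + int x * int a2 + int y * int a1)) = (\<Sum>v<n. f (int v))"
proof -
  let ?h = "\<lambda>(x, y). vtx n (int x * int a2 + int y * int a1)"
  let ?B = "{..<g} \<times> {..<n div g}"
  have inj: "inj_on ?h ?B" by (rule inj_on_coordinates[OF n g cop]) simp
  have "?h ` ?B \<subseteq> {..<n}" using vtx_less[OF n] by (auto split: prod.split)
  moreover have "card (?h ` ?B) = n"
    using card_image[OF inj] g by (simp add: card_cartesian_product)
  ultimately have img: "?h ` ?B = {..<n}" by (simp add: card_subset_eq)
  have "(\<Sum>v<n. f (int v)) = (\<Sum>v<n. f (c + int v))"
    by (rule sum_periodic_shift[OF n f, symmetric])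
  also have "\<dots> = (\<Sum>p\<in>?B. f (c + int (?h p)))"
    using sum.reindex[OF inj, of "\<lambda>v. f (c + int v)"] img by (simp add: comp_def)
  also have "\<dots> = (\<Sum>(x, y)\<in>?B. f (c + int x * int a2 + int y * int a1))"
  proof (rule sum.cong[OF refl], clarify)
    fix x y
    have "int (vtx n (int x * int a2 + int y * int a1)) = (int x * int a2 + int y * int a1) mod int n"
      using n by (simp add: vtx_def)
    then show "f (c + int (vtx n (int x * int a2 + int y * int a1))) = f (c + int x * int a2 + int y * int a1)"
      by (intro f) (simp add: cong_def mod_add_right_eq add.assoc)
  qed
  finally show ?thesis by (simp add: sum.cartesian_product)
qed

lemma tour_neighbours:
  assumes T: "is_tour n a1 a2 T" and v: "v < n"
  shows "card {w. {v, w} \<in> cycle_edges T} = 2"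
proof -
  have n: "3 \<le> n" and dist: "distinct T" and set: "set T = {..<n}"
    using T by (auto simp: is_tour_def)
  have len: "length T = n" using distinct_card[OF dist] set by simp
  obtain i where i: "i < n" "T ! i = v"
    using v set len by (metis in_set_conv_nth lessThan_iff)
  have nth_eq: "T ! j = T ! k \<longleftrightarrow> j = k" if "j < n" "k < n" for j k
    using that dist len nth_eq_iff_index_eq by metis
  define i' where "i' = (if i = 0 then n - 1 else i - 1)"
  have i': "i' < n" "Suc j mod n = i \<longleftrightarrow> j = i'" if "j < n" for j
    using that i n by (auto simp: i'_def mod_Suc)
  have "{v, w} \<in> cycle_edges T \<longleftrightarrow> w = T ! (Suc i mod n) \<or> w = T ! i'" for w
  proof -
    have "{v, w} \<in> cycle_edges T \<longleftrightarrow> (\<exists>j<n. {T ! i, w} = {T ! j, T ! (Suc j mod n)})"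
      using i by (simp add: cycle_edges_def len) blast
    also have "\<dots> \<longleftrightarrow> (\<exists>j<n. i = j \<and> w = T ! (Suc j mod n) \<or> i = Suc j mod n \<and> w = T ! j)"
      using nth_eq i(1) n by (auto simp: doubleton_eq_iff)
    also have "\<dots> \<longleftrightarrow> w = T ! (Suc i mod n) \<or> w = T ! i'"
      using i' i(1) by blast
    finally show ?thesis .
  qed
  then have "{w. {v, w} \<in> cycle_edges T} = {T ! (Suc i mod n), T ! i'}" by auto
  moreover have "T ! (Suc i mod n) \<noteq> T ! i'"
    using nth_eq[of "Suc i mod n" i'] i' i n by (auto simp: i'_def mod_Suc split: if_splits)
  ultimately show ?thesis by simp
qed

lemma tour_connected:
  assumes T: "is_tour n a1 a2 T" and u: "u \<in> W" "u < n"
    and closed: "\<And>v w. v \<in> W \<Longrightarrow> {v, w} \<in> cycle_edges T \<Longrightarrow> w \<in> W"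
  shows "{..<n} \<subseteq> W"
proof -
  have n: "0 < n" and dist: "distinct T" and set: "set T = {..<n}"
    using T by (auto simp: is_tour_def)
  have len: "length T = n" using distinct_card[OF dist] set by simp
  obtain i where i: "i < n" "T ! i = u"
    using u set len by (metis in_set_conv_nth lessThan_iff)
  have reach: "T ! ((i + k) mod n) \<in> W" for k
  proof (induction k)
    case 0 then show ?case using i u by simp
  next
    case (Suc k)
    have "{T ! ((i + k) mod n), T ! (Suc ((i + k) mod n) mod n)} \<in> cycle_edges T"
      using n by (auto simp: cycle_edges_def len)
    from closed[OF Suc this] show ?case by (simp add: mod_Suc_eq)
  qed
  show ?thesis
  proof
    fix v assume "v \<in> {..<n}"
    then obtain j where j: "j < n" "T ! j = v"
      using set len by (metis in_set_conv_nth)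
    \<comment> \<open>The extra \<open>n\<close> keeps the subtraction from being truncated when
      \<open>j < i\<close>.\<close>
    have "(i + (n + j - i)) mod n = j" using i j by simp
    then show "v \<in> W" using reach[of "n + j - i"] j by simp
  qed
qed

section \<open>Lower bound: parity of crossings and of missing vertical edges\<close>

text \<open>The strict bounds exclude \<open>a = n / 2\<close>, where \<open>z + a\<close> and
  \<open>z - a\<close> name the same vertex.\<close>

locale two_stripe_tour =
  fixes n a1 a2 g r :: nat and T :: "nat list"
  assumes T: "is_tour n a1 a2 T"
    and a_pos: "0 < a1" "0 < a2" and a_less: "2 * a1 < n" "2 * a2 < n" and a_neq: "a1 \<noteq> a2"
    and g: "g = gcd n a1" and cop: "coprime g a2"
    and r: "r = n div g"
begin

definition used :: "nat \<Rightarrow> int \<Rightarrow> nat" where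
  "used a z = of_bool ({vtx n z, vtx n (z + int a)} \<in> cycle_edges T)"

lemma n_pos: "0 < n"
  using T by (simp add: is_tour_def)

lemma n_eq: "n = g * r"
  unfolding r using g by simp

lemma r_pos: "0 < r"
  using n_pos n_eq by (metis mult_0_right neq0_conv)

lemma used_cong: "[z = w] (mod int n) \<Longrightarrow> used a z = used a w"
proof -
  assume "[z = w] (mod int n)"
  then have "vtx n z = vtx n w" "vtx n (z + int a) = vtx n (w + int a)"
    by (auto simp: vtx_eq_iff[OF n_pos] cong_add_rcancel)
  then show ?thesis by (simp add: used_def)
qed

lemma r_a1: "int n dvd int r * int a1"
proof -
  have "g * r dvd a1 * r" using g by (intro mult_dvd_mono) auto
  then show ?thesis unfolding n_eq by (metis mult.commute of_nat_dvd_iff of_nat_mult)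
qed

lemma level_cong: "[y = y'] (mod int r) \<Longrightarrow> [c + y * int a1 = c + y' * int a1] (mod int n)"
proof -
  assume "[y = y'] (mod int r)"
  then have "int r dvd y - y'" by (simp add: cong_iff_dvd_diff)
  then have "int r * int a1 dvd (y - y') * int a1" by (rule mult_dvd_mono) simp
  then have "int n dvd (y - y') * int a1" using r_a1 dvd_trans by blast
  then show ?thesis by (simp add: cong_iff_dvd_diff left_diff_distrib)
qed

text \<open>The four candidate neighbours differ pairwise by less than \<open>n\<close>, so they are
  distinct vertices. All parity arguments below sum this equation over a column, a level or all
  residues.\<close>

lemma degree: "used a1 z + used a1 (z - int a1) + used a2 z + used a2 (z - int a2) = 2"
proof -
  let ?P = "\<lambda>w. {vtx n z, vtx n w} \<in> cycle_edges T"
  let ?S = "{z + int a1, z - int a1, z + int a2, z - int a2}"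
  have inj: "inj_on (vtx n) ?S"
  proof (rule inj_onI)
    fix w w' assume w: "w \<in> ?S" "w' \<in> ?S" "vtx n w = vtx n w'"
    then have "int n dvd \<bar>w - w'\<bar>" by (simp add: vtx_eq_iff[OF n_pos] cong_iff_dvd_diff)
    moreover have "\<bar>w - w'\<bar> < int n" using w a_less a_pos by auto
    ultimately show "w = w'" using zdvd_imp_le[of "int n" "\<bar>w - w'\<bar>"] by fastforce
  qed
  have "{w. {vtx n z, w} \<in> cycle_edges T} = vtx n ` {w \<in> ?S. ?P w}"
  proof (intro set_eqI iffI)
    fix v assume "v \<in> {w. {vtx n z, w} \<in> cycle_edges T}"
    then have v: "{vtx n z, v} \<in> cycle_edges T" by simp
    then have st: "{vtx n z, v} \<in> stripe_edges n a1 \<union> stripe_edges n a2"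
      using T by (auto simp: is_tour_def)
    then have "v < n" using n_pos by (auto simp: stripe_edges_def doubleton_eq_iff)
    then have vv: "v = vtx n (int v)" by (simp add: vtx_of_nat)
    have "\<exists>w\<in>?S. [int v = w] (mod int n)"
    proof -
      have "[int v = z + int a1] (mod int n) \<or> [z = int v + int a1] (mod int n) \<or>
          [int v = z + int a2] (mod int n) \<or> [z = int v + int a2] (mod int n)"
        using st mem_stripe_edges_iff[OF n_pos, of z "int v"] vv by auto
      moreover have "[int v = z - int a] (mod int n)" if "[z = int v + int a] (mod int n)" for a
        using cong_diff[OF cong_sym[OF that] cong_refl[of "int a"]] by simp
      ultimately show ?thesis by blast
    qed
    then obtain w where "w \<in> ?S" "v = vtx n w" using vv by (metis vtx_eq_iff[OF n_pos])
    then show "v \<in> vtx n ` {w \<in> ?S. ?P w}" using v by blast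
  qed auto
  then have "card (vtx n ` {w \<in> ?S. ?P w}) = 2"
    using tour_neighbours[OF T vtx_less[OF n_pos]] by metis
  moreover have "card (vtx n ` {w \<in> ?S. ?P w}) = card {w \<in> ?S. ?P w}"
    by (rule card_image[OF inj_on_subset[OF inj]]) blast
  ultimately have "2 = card {w \<in> ?S. ?P w}" by linarith
  also have "\<dots> = card (?S \<inter> {w. ?P w})" by (rule arg_cong[of _ _ card]) blast
  also have "\<dots> = (\<Sum>w\<in>?S. of_bool (?P w))"
    by (subst sum_of_bool_eq) (simp_all only: finite.intros of_nat_id)
  also have "\<dots> = of_bool (?P (z + int a1)) + (of_bool (?P (z - int a1)) + (of_bool (?P (z + int a2)) + of_bool (?P (z - int a2))))"
  proof -
    have "z + int a1 \<notin> {z - int a1, z + int a2, z - int a2}" "z - int a1 \<notin> {z + int a2, z - int a2}"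
      "z + int a2 \<notin> {z - int a2}"
      using a_neq a_pos by auto
    then show ?thesis by (simp only: sum.insert finite.intros sum.empty not_False_eq_True empty_iff add_0_right)
  qed
  finally show ?thesis by (simp add: used_def insert_commute)
qed

lemma cost_eq: "tour_cost n a2 T = (\<Sum>v<n. used a2 (int v))"
proof -
  let ?e = "\<lambda>z. {vtx n z, vtx n (z + int a2)}"
  let ?U = "{v. v < n \<and> ?e (int v) \<in> cycle_edges T}"
  have "inj_on (\<lambda>v. ?e (int v)) {..<n}"
  proof (rule inj_onI)
    fix v w assume vw: "v \<in> {..<n}" "w \<in> {..<n}" and "?e (int v) = ?e (int w)"
    then consider "[int v = int w] (mod int n)"
      | "[int v = int w + int a2] (mod int n)" "[int v + int a2 = int w] (mod int n)"
      by (auto simp: doubleton_eq_iff vtx_eq_iff[OF n_pos])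
    then show "v = w"
    proof cases
      case 1 then show ?thesis using vw by (simp add: cong_def)
    next
      case 2
      then have "int n dvd int v + int a2 - int w" "int n dvd int v - (int w + int a2)"
        by (simp_all add: cong_iff_dvd_diff)
      from dvd_diff[OF this] have "int n dvd 2 * int a2" by simp
      then show ?thesis using zdvd_imp_le[of "int n" "2 * int a2"] a_less a_pos by simp
    qed
  qed
  then have "inj_on (\<lambda>v. ?e (int v)) ?U" by (rule inj_on_subset) auto
  moreover have "cycle_edges T \<inter> stripe_edges n a2 = (\<lambda>v. ?e (int v)) ` ?U"
  proof -
    have "stripe_edges n a2 = (\<lambda>v. ?e (int v)) ` {..<n}"
    proof -
      have "?e (int v) = {v, (v + a2) mod n}" if "v < n" for v
        using vtx_of_nat[OF that] vtx_add[OF n_pos, of "int v" a2] by simp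
      then have "(\<lambda>v. ?e (int v)) ` {..<n} = (\<lambda>v. {v, (v + a2) mod n}) ` {..<n}"
        by (intro image_cong) simp_all
      then show ?thesis unfolding stripe_edges_def by auto
    qed
    then show ?thesis by auto
  qed
  ultimately have "tour_cost n a2 T = card ?U"
    unfolding tour_cost_def by (simp add: card_image)
  also have "\<dots> = card ({..<n} \<inter> {v. ?e (int v) \<in> cycle_edges T})"
    by (rule arg_cong[of _ _ card]) auto
  also have "\<dots> = (\<Sum>v<n. used a2 (int v))"
    unfolding used_def by simp
  finally show ?thesis .
qed

text \<open>Counts the tour edges between columns \<open>x\<close> and \<open>x + 1\<close>. Taking
  \<open>x\<close> from all integers avoids a special case at the seam.\<close>

definition crossings :: "int \<Rightarrow> nat" where
  "crossings x = (\<Sum>y<r. used a2 (x * int a2 + int y * int a1))"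

text \<open>Summing \<open>degree\<close> over column \<open>x\<close> counts each of its vertical
  edges twice, and the total \<open>2 * r\<close> is even.\<close>

lemma even_crossings_step: "even (crossings x + crossings (x - 1))"
proof -
  define V where "V y = used a1 (x * int a2 + y * int a1)" for y
  have "V y = V y'" if "[y = y'] (mod int r)" for y y'
    unfolding V_def by (intro used_cong level_cong that)
  from sum_periodic_shift[OF r_pos this, where c = "-1"]
  have shift: "(\<Sum>y<r. V (int y - 1)) = (\<Sum>y<r. V (int y))" by simp
  have "2 * r = (\<Sum>y<r. V (int y) + V (int y - 1) + used a2 (x * int a2 + int y * int a1)
      + used a2 ((x - 1) * int a2 + int y * int a1))"
  proof -
    have "V (int y) + V (int y - 1) + used a2 (x * int a2 + int y * int a1)
      + used a2 ((x - 1) * int a2 + int y * int a1) = 2" for y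
      using degree[of "x * int a2 + int y * int a1"] by (simp add: V_def algebra_simps)
    then show ?thesis by simp
  qed
  also have "\<dots> = 2 * (\<Sum>y<r. V (int y)) + (crossings x + crossings (x - 1))"
    by (simp add: sum.distrib shift crossings_def)
  finally show ?thesis by presburger
qed

lemma odd_crossings_iff: "odd (crossings x) \<longleftrightarrow> odd (crossings y)"
proof -
  have "odd (crossings x) \<longleftrightarrow> odd (crossings 0)" for x
  proof (induction x rule: int_induct[where k = 0])
    case base show ?case ..
  next
    case (step1 i) then show ?case using even_crossings_step[of "i + 1"] by simp
  next
    case (step2 i) then show ?case using even_crossings_step[of i] by simp
  qed
  then show ?thesis by blast
qed

lemma cost_eq_crossings: "tour_cost n a2 T = (\<Sum>x<g. crossings (int x))"
  using sum_coordinates[OF n_pos g cop, of "used a2" 0, OF used_cong] cost_eq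
  unfolding crossings_def r[symmetric] by simp

lemma crossings_0D:
  assumes "crossings x = 0"
  shows "used a2 (x * int a2 + y * int a1) = 0"
proof -
  have "nat (y mod int r) < r" using r_pos by (simp add: nat_less_iff)
  moreover have "\<forall>k<r. used a2 (x * int a2 + int k * int a1) = 0"
    using assms by (simp add: crossings_def)
  ultimately have "used a2 (x * int a2 + int (nat (y mod int r)) * int a1) = 0" by blast
  moreover have "[int (nat (y mod int r)) = y] (mod int r)" using r_pos by (simp add: cong_def)
  ultimately show ?thesis using used_cong[OF level_cong] by metis
qed

text \<open>The columns from \<open>x + 1\<close> to \<open>x'\<close> would be closed under tour
  edges and yet omit column \<open>x\<close>, against connectedness.\<close>

lemma no_two_empty_crossings:
  assumes "crossings (int x) = 0" "crossings (int x') = 0" "x < x'" "x' < g"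
  shows False
proof -
  define W where "W = {vtx n (i * int a2 + j * int a1) | i j. int x < i \<and> i \<le> int x'}"
  have WI: "vtx n z \<in> W" if "z = i * int a2 + j * int a1" "int x < i" "i \<le> int x'" for z i j
    using that by (auto simp: W_def)
  have "{..<n} \<subseteq> W"
  proof (rule tour_connected[OF T])
    show "vtx n (int x' * int a2) \<in> W" using assms by (intro WI[of _ _ 0]) auto
    show "vtx n (int x' * int a2) < n" by (rule vtx_less[OF n_pos])
    fix v w assume "v \<in> W" and vw: "{v, w} \<in> cycle_edges T"
    then obtain i j where ij: "int x < i" "i \<le> int x'" and v: "v = vtx n (i * int a2 + j * int a1)"
      by (auto simp: W_def)
    define z where "z = i * int a2 + j * int a1"
    have st: "{v, w} \<in> stripe_edges n a1 \<union> stripe_edges n a2"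
      using T vw by (auto simp: is_tour_def)
    then have "w < n" using n_pos by (auto simp: stripe_edges_def doubleton_eq_iff)
    then have ww: "w = vtx n (int w)" by (simp add: vtx_of_nat)
    have minus: "[int w = z - int a] (mod int n)" if "[z = int w + int a] (mod int n)" for a
      using cong_diff[OF cong_sym[OF that] cong_refl[of "int a"]] by simp
    have "[int w = z + int a1] (mod int n) \<or> [int w = z - int a1] (mod int n) \<or>
          [int w = z + int a2] (mod int n) \<or> [int w = z - int a2] (mod int n)"
      using st mem_stripe_edges_iff[OF n_pos, of z "int w"] ww minus unfolding v z_def by auto
    then consider "w = vtx n (z + int a1)" | "w = vtx n (z - int a1)"
      | "w = vtx n (z + int a2)" | "w = vtx n (z - int a2)"
      using ww by (metis vtx_eq_iff[OF n_pos])
    then show "w \<in> W"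
    proof cases
      case 1
      then show ?thesis using ij by (auto simp: z_def algebra_simps intro!: WI[of _ i "j + 1"])
    next
      case 2
      then show ?thesis using ij by (auto simp: z_def algebra_simps intro!: WI[of _ i "j - 1"])
    next
      case 3
      then have "used a2 z = 1" using vw v by (simp add: used_def z_def)
      then have "i \<noteq> int x'" using crossings_0D[OF assms(2), of j] by (auto simp: z_def)
      then show ?thesis using 3 ij by (auto simp: z_def algebra_simps intro!: WI[of _ "i + 1" j])
    next
      case 4
      then have "used a2 (z - int a2) = 1" using vw v by (simp add: used_def z_def insert_commute)
      then have "i \<noteq> int x + 1"
        using crossings_0D[OF assms(1), of j] by (auto simp: z_def algebra_simps)
      then show ?thesis using 4 ij by (auto simp: z_def algebra_simps intro!: WI[of _ "i - 1" j])
    qed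
  qed
  then have "vtx n (int x * int a2) \<in> W" using vtx_less[OF n_pos] by auto
  then obtain i j where ij: "int x < i" "i \<le> int x'"
      and eq: "vtx n (int x * int a2) = vtx n (i * int a2 + j * int a1)"
    by (auto simp: W_def)
  have "int g dvd int n" "int g dvd int a1" using g by simp_all
  moreover have "int n dvd (i - int x) * int a2 + j * int a1"
    using eq cong_sym by (fastforce simp: vtx_eq_iff[OF n_pos] cong_iff_dvd_diff algebra_simps)
  ultimately have "int g dvd (i - int x) * int a2"
    by (metis dvd_add_left_iff dvd_mult dvd_trans)
  then have "int g dvd i - int x" using cop by (simp add: coprime_dvd_mult_left_iff)
  then have "int g \<le> i - int x" by (rule zdvd_imp_le) (use ij in simp)
  then show False using ij assms(4) by linarith
qed

lemma cost_ge_if_even_crossings: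
  assumes "even (crossings 0)"
  shows "2 * g \<le> tour_cost n a2 T + 2"
proof -
  define Z where "Z = {x \<in> {..<g}. crossings (int x) = 0}"
  have two_le: "2 \<le> crossings (int x)" if "x \<in> {..<g} - Z" for x
  proof -
    have "even (crossings (int x))" using assms odd_crossings_iff by blast
    moreover have "crossings (int x) \<noteq> 0" using that by (simp add: Z_def)
    ultimately show ?thesis by presburger
  qed
  have "x = x'" if "x \<in> Z" "x' \<in> Z" for x x'
    using no_two_empty_crossings[of x x'] no_two_empty_crossings[of x' x] that
    by (cases x x' rule: linorder_cases) (auto simp: Z_def)
  then have "card Z \<le> Suc 0" by (intro card_le_Suc0_iff_eq[THEN iffD2]) (auto simp: Z_def)
  then have "g \<le> card ({..<g} - Z) + 1"
    by (subst card_Diff_subset) (auto simp: Z_def)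
  moreover have "2 * card ({..<g} - Z) \<le> (\<Sum>x\<in>{..<g} - Z. crossings (int x))"
    using sum_bounded_below[of "{..<g} - Z" 2 "\<lambda>x. crossings (int x)"] two_le
    by (simp add: mult.commute)
  moreover have "\<dots> \<le> (\<Sum>x<g. crossings (int x))" by (rule sum_mono2) auto
  ultimately show ?thesis unfolding cost_eq_crossings by linarith
qed

text \<open>Equivalently, the tour misses exactly as many vertical edges as it uses horizontal
  ones.\<close>

lemma sum_used_a1: "(\<Sum>v<n. used a1 (int v)) + tour_cost n a2 T = n"
proof -
  have shift: "(\<Sum>v<n. used a (int v - int b)) = (\<Sum>v<n. used a (int v))" for a b
    using sum_periodic_shift[OF n_pos used_cong, where c = "- int b"] by simp
  have "2 * n = (\<Sum>v<n. used a1 (int v) + used a1 (int v - int a1) + used a2 (int v) + used a2 (int v - int a2))"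
    by (simp add: degree)
  also have "\<dots> = 2 * (\<Sum>v<n. used a1 (int v)) + 2 * tour_cost n a2 T"
    unfolding cost_eq sum.distrib shift by simp
  finally show ?thesis by simp
qed

text \<open>By the hypothesis on \<open>t\<close>, passing \<open>g\<close> columns shifts the
  levels by \<open>t\<close>. The witness \<open>w\<close> is the signed length of the arc on which
  each level misses an odd number of vertical edges: \<open>d\<close> upwards or
  \<open>r - d\<close> downwards.\<close>

lemma winding_if_single_crossing:
  assumes x0: "crossings x0 = 1"
    and t: "[t * int a1 + int g * int a2 = 0] (mod int n)"
  shows "\<exists>w. \<bar>w\<bar> \<le> int (tour_cost n a2 T) \<and> even (w + int (tour_cost n a2 T)) \<and>
    [w * int a1 + int g * int a2 = 0] (mod int n)"
proof -
  have level: "used a2 (x * int a2 + y * int a1) = used a2 (x * int a2 + y' * int a1)"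
    if "[y = y'] (mod int r)" for x y y'
    by (rule used_cong[OF level_cong[OF that]])
  have "card {y. y < r \<and> used a2 (x0 * int a2 + int y * int a1) = 1} = 1"
    (is "card ?Y = 1")
  proof -
    have "crossings x0 = (\<Sum>y<r. of_bool (used a2 (x0 * int a2 + int y * int a1) = 1))"
      unfolding crossings_def by (rule sum.cong) (auto simp: used_def)
    also have "\<dots> = card ?Y" by (simp add: Int_def)
    finally show ?thesis using x0 by simp
  qed
  then obtain b where b: "?Y = {b}" by (auto simp: card_1_singleton_iff)
  have single: "used a2 (x0 * int a2 + y * int a1) = of_bool ([y = int b] (mod int r))" for y
  proof -
    define y' where "y' = nat (y mod int r)"
    have y': "y' < r" "[y = int y'] (mod int r)"
      using r_pos by (simp_all add: y'_def nat_less_iff cong_def)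
    have "b < r" using b by auto
    then have "[y = int b] (mod int r) \<longleftrightarrow> y' = b"
      using y' by (auto simp: cong_def)
    moreover have "y' \<in> ?Y \<longleftrightarrow> y' = b" using b by simp
    moreover have "used a2 (x0 * int a2 + int y' * int a1) \<in> {0, 1}" by (simp add: used_def)
    ultimately show ?thesis using y'(1) level[OF y'(2), of x0] by auto
  qed
  \<comment> \<open>The torus is cut between columns \<open>x0\<close> and \<open>x0 + 1\<close>.
    \<open>q y\<close> counts the vertical edges above level \<open>y\<close>;
    \<open>\<beta> y 0\<close> and \<open>\<beta> y g\<close> are the two sides of the cut.\<close>
  define q where "q y = (\<Sum>x<g. used a1 ((x0 + 1 + int x) * int a2 + y * int a1))" for y
  define \<beta> where "\<beta> y x = used a2 ((x0 + int x) * int a2 + y * int a1)" for y x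
  \<comment> \<open>Inner horizontal edges of a level are counted twice, so modulo 2 only the two
    sides of the cut remain.\<close>
  have row: "even (q y + q (y - 1) + \<beta> y 0 + \<beta> y g)" for y
  proof -
    have "2 * g = (\<Sum>x<g. used a1 ((x0 + 1 + int x) * int a2 + y * int a1)
        + used a1 ((x0 + 1 + int x) * int a2 + (y - 1) * int a1) + \<beta> y (Suc x) + \<beta> y x)"
    proof -
      have "used a1 ((x0 + 1 + int x) * int a2 + y * int a1)
        + used a1 ((x0 + 1 + int x) * int a2 + (y - 1) * int a1) + \<beta> y (Suc x) + \<beta> y x = 2" for x
        using degree[of "(x0 + 1 + int x) * int a2 + y * int a1"]
        by (simp add: \<beta>_def algebra_simps)
      then show ?thesis by simp
    qed
    also have "\<dots> = q y + q (y - 1) + (\<Sum>x<g. \<beta> y (Suc x)) + (\<Sum>x<g. \<beta> y x)"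
      by (simp add: sum.distrib q_def)
    finally have "2 * g = q y + q (y - 1) + (\<Sum>x<g. \<beta> y (Suc x)) + (\<Sum>x<g. \<beta> y x)" .
    moreover have "(\<Sum>x<g. \<beta> y x) + \<beta> y g = \<beta> y 0 + (\<Sum>x<g. \<beta> y (Suc x))"
      using sum.lessThan_Suc[of "\<beta> y" g] sum.lessThan_Suc_shift[of "\<beta> y" g] by simp
    ultimately show ?thesis by presburger
  qed
  define d where "d = nat (t mod int r)"
  have d: "d < r" "[int d = t] (mod int r)"
    using r_pos by (simp_all add: d_def nat_less_iff cong_def)
  \<comment> \<open>With levels counted from \<open>b\<close>, the single crossing edge appears on
    one side of the cut at level 0 and on the other at level \<open>d\<close>.\<close>
  have ends: "\<beta> (int b + int i) 0 = of_bool (i = 0)" "\<beta> (int b + int i) g = of_bool (i = d)"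
    if i: "i < r" for i
  proof -
    have "[int b + int i = int b] (mod int r) \<longleftrightarrow> i = 0"
      using i cong_add_lcancel[of "int b" "int i" 0 "int r"] by (auto simp: cong_def)
    then show "\<beta> (int b + int i) 0 = of_bool (i = 0)" by (simp add: \<beta>_def single)
    have "[(x0 + int g) * int a2 + (int b + int i) * int a1
        = x0 * int a2 + (int b + int i - t) * int a1] (mod int n)"
      using t by (simp add: cong_iff_dvd_diff algebra_simps)
    then have "\<beta> (int b + int i) g = used a2 (x0 * int a2 + (int b + int i - t) * int a1)"
      unfolding \<beta>_def by (rule used_cong)
    moreover have "[int b + int i - t = int b] (mod int r) \<longleftrightarrow> i = d"
    proof -
      have "[int b + int i - t = int b] (mod int r) \<longleftrightarrow> [int i = t] (mod int r)"
        by (simp add: cong_iff_dvd_diff)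
      also have "\<dots> \<longleftrightarrow> [int i = int d] (mod int r)"
        using d(2) cong_sym cong_trans by meson
      also have "\<dots> \<longleftrightarrow> i = d" using i d(1) by (auto simp: cong_def)
      finally show ?thesis .
    qed
    ultimately show "\<beta> (int b + int i) g = of_bool (i = d)" by (simp add: single)
  qed
  define p where "p i = q (int b + int i)" for i
  \<comment> \<open>The summand 1 is the change at level 0, the last one the change at level
    \<open>d\<close>; for \<open>d = 0\<close> they cancel.\<close>
  have parity: "even (p i + q (int b - 1) + 1 + of_bool (d \<le> i))" if "i < r" for i
    using that
  proof (induction i)
    case 0
    then show ?case using row[of "int b"] ends[of 0] by (auto simp: p_def)
  next
    case (Suc i)
    then have "even (p i + q (int b - 1) + 1 + of_bool (d \<le> i))" by simp
    moreover have "even (p (Suc i) + p i + of_bool (Suc i = d))"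
      using row[of "int b + int (Suc i)"] ends[OF Suc.prems] by (simp add: p_def)
    ultimately show ?case by (auto simp: of_bool_def split: if_splits)
  qed
  have p_le: "p i \<le> g" for i
  proof -
    have "p i \<le> (\<Sum>x<g. 1)" unfolding p_def q_def by (rule sum_mono) (simp add: used_def)
    then show ?thesis by simp
  qed
  have cost: "tour_cost n a2 T = (\<Sum>i<r. g - p i)"
  proof -
    have "(\<Sum>v<n. used a1 (int v)) = (\<Sum>i<r. p i)"
      using sum_coordinates[OF n_pos g cop, of "used a1" "(x0 + 1) * int a2 + int b * int a1", OF used_cong]
      unfolding p_def q_def r[symmetric]
      by (subst sum.swap) (simp add: algebra_simps)
    moreover have "(\<Sum>i<r. p i) + (\<Sum>i<r. g - p i) = n"
      using p_le by (simp add: sum.distrib[symmetric] n_eq mult.commute)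
    ultimately show ?thesis using sum_used_a1 by linarith
  qed
  define Odd where "Odd = {i. i < r \<and> odd (g - p i)}"
  have odd_iff: "odd (g - p i) \<longleftrightarrow> (even (g + q (int b - 1)) \<longleftrightarrow> i < d)" if "i < r" for i
    using parity[OF that] p_le[of i] by (auto simp: of_bool_def split: if_splits)
  have "card Odd \<le> tour_cost n a2 T"
  proof -
    have "card Odd = (\<Sum>i\<in>Odd. 1)" by simp
    also have "\<dots> \<le> (\<Sum>i\<in>Odd. g - p i)" 
    proof (rule sum_mono)
      fix i assume "i \<in> Odd"
      then have "odd (g - p i)" unfolding Odd_def by blast
      then have "0 < g - p i" by (rule odd_pos)
      then show "1 \<le> g - p i" by simp
    qed
    also have "\<dots> \<le> (\<Sum>i<r. g - p i)" by (rule sum_mono2) (auto simp: Odd_def)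
    finally show ?thesis by (simp add: cost)
  qed
  moreover have "even (card Odd + tour_cost n a2 T)"
    unfolding cost using even_sum_iff[of "{..<r}" "\<lambda>i. g - p i"] by (simp add: Odd_def)
  moreover have winding: "[w * int a1 + int g * int a2 = 0] (mod int n)" if "[w = t] (mod int r)" for w
    using cong_trans[OF level_cong[OF that, of "int g * int a2"]] t by (simp add: add.commute)
  moreover note winding[OF d(2)]
  moreover have "[(int d - int r) * int a1 + int g * int a2 = 0] (mod int n)"
    using d(2) by (intro winding) (simp add: cong_def)
  \<comment> \<open>Which arc is odd depends on the level just below the cut edge. Either will do,
    since \<open>d\<close> and \<open>d - r\<close> describe the same twist.\<close>
  moreover have "card Odd = d \<or> card Odd = r - d"
  proof (cases "even (g + q (int b - 1))")
    case True
    then have "Odd = {i. i < r \<and> i < d}" using odd_iff unfolding Odd_def by blast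
    also have "\<dots> = {..<d}" using d(1) by auto
    finally have "Odd = {..<d}" .
    then show ?thesis by simp
  next
    case False
    then have "Odd = {i. i < r \<and> \<not> i < d}" using odd_iff unfolding Odd_def by blast
    also have "\<dots> = {d..<r}" by auto
    finally have "Odd = {d..<r}" .
    then show ?thesis by simp
  qed
  ultimately show ?thesis
  proof (elim disjE)
    assume "card Odd = d" "card Odd \<le> tour_cost n a2 T" "even (card Odd + tour_cost n a2 T)"
      "[int d * int a1 + int g * int a2 = 0] (mod int n)"
    then show ?thesis by (intro exI[of _ "int d"]) auto
  next
    assume "card Odd = r - d" "card Odd \<le> tour_cost n a2 T" "even (card Odd + tour_cost n a2 T)"
      "[(int d - int r) * int a1 + int g * int a2 = 0] (mod int n)"
    then show ?thesis using d(1) by (intro exI[of _ "int d - int r"]) (auto simp: of_nat_diff)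
  qed
qed

lemma winding_if_cheap:
  assumes cheap: "tour_cost n a2 T + 2 < 2 * g"
    and t: "[t * int a1 + int g * int a2 = 0] (mod int n)"
  shows "even (tour_cost n a2 T + g)"
    and "\<exists>w. \<bar>w\<bar> \<le> int (tour_cost n a2 T) \<and> even (w + int (tour_cost n a2 T)) \<and>
      [w * int a1 + int g * int a2 = 0] (mod int n)"
proof -
  have odd: "odd (crossings x)" for x
    using cost_ge_if_even_crossings odd_crossings_iff[of x 0] cheap by linarith
  then show "even (tour_cost n a2 T + g)"
    unfolding cost_eq_crossings using even_sum_iff[of "{..<g}" "\<lambda>x. crossings (int x)"] by simp
  \<comment> \<open>All crossing numbers are odd; if none were 1, the \<open>g\<close> columns would
    cost at least \<open>2 * g\<close>.\<close>
  have "\<exists>x0. crossings x0 = 1"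
  proof (rule ccontr)
    assume "\<not> (\<exists>x0. crossings x0 = 1)"
    then have "2 \<le> crossings x" for x using odd[of x]
      by (metis One_nat_def even_zero le_SucE not_less_eq_eq one_le_numeral le_zero_eq numeral_2_eq_2 not_less_eq)
    then have "2 * g \<le> tour_cost n a2 T"
      unfolding cost_eq_crossings using sum_bounded_below[of "{..<g}" 2 "\<lambda>x. crossings (int x)"] by simp
    then show False using cheap by simp
  qed
  then show "\<exists>w. \<bar>w\<bar> \<le> int (tour_cost n a2 T) \<and> even (w + int (tour_cost n a2 T)) \<and>
      [w * int a1 + int g * int a2 = 0] (mod int n)"
    using winding_if_single_crossing t by blast
qed

end


section \<open>The two bounds expressed through \<open>S\<close>\<close>

text \<open>An admissible winding is \<open>2 * y - g1\<close> with \<open>y\<close> in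
  \<open>S\<close> modulo \<open>n div g1\<close>. Its upward extreme is
  \<open>2 * y1 - g1 = g1 + 2 * (y1 - g1)\<close>, its downward extreme has length
  \<open>g1 + 2 * (n div g1 - y2)\<close>; the shorter is the optimal cost.\<close>

theorem theorem6:
  fixes n a1 a2 g1 c :: nat and S :: "int set" and y1 y2 m :: int and T :: "nat list"
  assumes "a1 \<in> {1..n div 2}" and "a2 \<in> {1..n div 2}" and "a1 \<noteq> a2"
    and "gcd n a1 > 1" and "gcd (gcd n a1) a2 = 1"
    and "g1 = gcd n a1" and "c = g1"
    and "g1 + 1 < n div g1"
    and "S = {y. 0 \<le> y \<and> y < int (n div g1) \<and>
                 [(2 * y - int g1) * int a1 + int g1 * int a2 = 0] (mod int n)}"
    and "S \<noteq> {}" and "y1 = Min S" and "y2 = Max S"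
    and "y1 > int g1"
    and "is_optimal_tour n a1 a2 T"
    and "int c < int (tour_cost n a2 T)" and "int (tour_cost n a2 T) < 2 * int c - 2"
  shows "int (tour_cost n a2 T) = int c + 2 * m \<longleftrightarrow> m = min (y1 - int g1) (int (n div g1) - y2)"
proof -
  define r where "r = n div g1"
  let ?K = "int (tour_cost n a2 T)"
  define M where "M = min (y1 - int g1) (int r - y2)"
  have M_cases: "M = y1 - int g1 \<or> M = int r - y2" and M_le: "M \<le> y1 - int g1" "M \<le> int r - y2"
    unfolding M_def by linarith+
  note a = assms(1-3) and g = assms(6)
  have cop: "coprime g1 a2" using assms(5) g by (simp add: coprime_iff_gcd_eq_1)
  have g2: "2 \<le> g1" using assms(4) g by simp
  have T: "is_tour n a1 a2 T" and opt: "\<And>T'. is_tour n a1 a2 T' \<Longrightarrow> tour_cost n a2 T \<le> tour_cost n a2 T'"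
    using assms(14) by (auto simp: is_optimal_tour_def)
  have n: "n = g1 * r" using g by (simp add: r_def)
  have r: "g1 + 1 < r" using assms(8) by (simp add: r_def)
  have S: "y \<in> S \<longleftrightarrow> 0 \<le> y \<and> y < int r \<and>
      [(2 * y - int g1) * int a1 + int g1 * int a2 = 0] (mod int n)" for y
    unfolding assms(9) r_def by (rule mem_Collect_eq)
  have "S \<subseteq> {0..<int r}" using S by (meson atLeastLessThan_iff subsetI)
  then have fin: "finite S" by (rule finite_subset) simp
  have y12: "y1 \<in> S" "y2 \<in> S"
    unfolding assms(11,12) by (rule Min_in Max_in, fact fin, fact assms(10))+
  have bounds: "y1 \<le> y \<and> y \<le> y2" if "y \<in> S" for y
    unfolding assms(11,12) using Min_le[OF fin that] Max_ge[OF fin that] by blast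
  have "2 * a1 \<noteq> n"
  proof
    assume "2 * a1 = n"
    then have "a1 dvd n" by (metis dvd_triv_right)
    then have "g1 = a1" unfolding g by (rule gcd_nat.absorb2)
    then have "g1 * r = g1 * 2" using \<open>2 * a1 = n\<close> n by (metis mult.commute)
    then have "r = 2" using g2 by simp
    then show False using r g2 by simp
  qed
  moreover have "2 * a2 \<noteq> n"
  proof
    assume "2 * a2 = n"
    then have "g1 dvd 2 * a2" using n by simp
    then have "g1 dvd 2" using cop by (simp add: coprime_dvd_mult_left_iff)
    then have "g1 \<le> 2" by (rule dvd_imp_le) simp
    \<comment> \<open>For \<open>g1 = 2\<close> no cost lies strictly between \<open>c\<close> and
      \<open>2 * c - 2\<close>.\<close>
    then show False using assms(7,15,16) by linarith
  qed
  ultimately interpret two_stripe_tour n a1 a2 g1 r T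
    using T a g cop by unfold_locales (auto simp: r_def)
  have cheap: "tour_cost n a2 T + 2 < 2 * g1" using assms(7,16) by linarith
  have t: "[(2 * y1 - int g1) * int a1 + int g1 * int a2 = 0] (mod int n)" using y12(1) S by blast
  from winding_if_cheap[OF cheap t] obtain w where even: "even (?K + int g1)"
    and w: "\<bar>w\<bar> \<le> ?K" "even (w + ?K)" "[w * int a1 + int g1 * int a2 = 0] (mod int n)"
    by (metis even_of_nat of_nat_add)
  have "even (?K - int g1)" "even (w + int g1)" using even w(2) by presburger+
  then obtain k y where k: "?K = int g1 + 2 * k" and y: "w = 2 * y - int g1"
    by (metis add_diff_cancel_right' add_diff_cancel_left' diff_add_cancel dvdE add.commute)
  have lower: "M \<le> k"
  proof -
    have "2 * y - int g1 = 2 * (y mod int r) - int g1 + int r * (2 * (y div int r))"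
      using mult_div_mod_eq[of "int r" y] by linarith
    then have "[2 * (y mod int r) - int g1 = w] (mod int r)"
      by (simp add: y cong_iff_dvd_diff)
    from level_cong[OF this, of "int g1 * int a2"]
    have "[(2 * (y mod int r) - int g1) * int a1 + int g1 * int a2 = 0] (mod int n)"
      using w(3) cong_trans by (fastforce simp: add.commute)
    moreover have "0 \<le> y mod int r" "y mod int r < int r" using r_pos by simp_all
    ultimately have "y mod int r \<in> S" using S by blast
    then have *: "y1 \<le> y mod int r" "y mod int r \<le> y2" using bounds by auto
    show ?thesis
    proof (cases "0 \<le> y")
      case True
      then have "y mod int r \<le> y" by (simp add: zmod_le_nonneg_dividend)
      then show ?thesis using * M_le w(1) k y by linarith
    next
      case False
      \<comment> \<open>Reduction raises a negative \<open>y\<close> by at least \<open>r\<close>,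
        so \<open>y\<close> is at most \<open>y2 - r\<close> and the downward arc applies.\<close>
      then have "y div int r < 0" using r_pos by (intro div_neg_pos_less0) simp_all
      then have "int r * (y div int r) \<le> int r * (- 1)" by (intro mult_left_mono) simp_all
      then have "y + int r \<le> y mod int r" using mult_div_mod_eq[of "int r" y] by linarith
      then show ?thesis using * M_le w(1) k y by linarith
    qed
  qed
  have "y2 < int r" using y12(2) S by blast
  then have M: "0 \<le> M" using M_cases assms(13) by linarith
  have "y1 \<le> y2" using bounds y12(2) by blast
  \<comment> \<open>The tour is built with \<open>b = a1\<close> for the upward arc and with
    \<open>b = - a1\<close> for the downward one.\<close>
  have "\<exists>b. (b = int a1 \<or> b = - int a1) \<and> [int g1 * int a2 + (int g1 + 2 * M) * b = 0] (mod int n)"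
    using M_cases
  proof
    assume "M = y1 - int g1"
    then have M_eq: "int g1 + 2 * M = 2 * y1 - int g1" by linarith
    show ?thesis
      unfolding M_eq using t by (intro exI[of _ "int a1"]) (simp add: add.commute)
  next
    assume M_eq: "M = int r - y2"
    have "[- (int g1 + 2 * M) = 2 * y2 - int g1] (mod int r)"
      unfolding M_eq by (simp add: cong_iff_dvd_diff)
    note level_cong[OF this, of "int g1 * int a2"]
    also have "[int g1 * int a2 + (2 * y2 - int g1) * int a1 = 0] (mod int n)"
      using y12(2) S by (simp add: add.commute)
    finally have "[int g1 * int a2 + - (int g1 + 2 * M) * int a1 = 0] (mod int n)" .
    then show ?thesis
      by (intro exI[of _ "- int a1"]) (simp only: mult_minus_left mult_minus_right simp_thms)
  qed
  then obtain b where b: "b = int a1 \<or> b = - int a1"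
    and shift: "[int g1 * int a2 + (int g1 + 2 * M) * b = 0] (mod int n)" by blast
  have M_nat: "int g1 + 2 * M = int (g1 + 2 * nat M)" using M by simp
  \<comment> \<open>The two candidate lengths add up to \<open>2 * r - 2 * (y2 - y1)\<close>, so the
    shorter is at most \<open>r\<close>.\<close>
  have "int g1 + 2 * M \<le> int r" using M_le \<open>y1 \<le> y2\<close> by linarith
  then have "g1 + 2 * nat M \<le> n div g1" unfolding M_nat r_def by (simp only: of_nat_le_iff)
  from tour_of_cost_le[OF a g g2 cop this b shift[unfolded M_nat]]
  obtain T' where "is_tour n a1 a2 T'" "tour_cost n a2 T' \<le> g1 + 2 * nat M" by blast
  then have "?K \<le> int g1 + 2 * M" using opt M by fastforce
  then have "k = M" using lower k by linarith
  then show ?thesis using k assms(7) unfolding M_def r_def by auto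
qed

end
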